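(* Let $\Phi$ be an irreducible crystallographic reduced root system with basis $\Delta$ and let $\alpha\in\Delta$ be a maximal root. The facet $F(\alpha)$ is integrally closed in $R$ if and only if $(\check\omega_\alpha,\theta)=1$.
   Context: $\Phi$ spans the Euclidean space $E$ with scalar product $(\cdot,\cdot)$; $R$ is the $\mathbb{Z}$-span of $\Phi$; $\theta$ is the highest root with respect to $\Delta$; $\check\omega_\alpha\in E$, $\alpha\in\Delta$, is the dual basis of $\Delta$ (fundamental coweights). The root polytope $\mathcal{P}_\Phi$ is the convex hull of $\Phi$. A simple root $\alpha$ is maximal if its complement in the affine (extended) Dynkin diagram of $\Phi$ is connected. For a maximal $\alpha$, $F(\alpha)=\{u\in\mathcal{P}_\Phi\mid(\check\omega_\alpha,u)=(\check\omega_\alpha,\theta)\}$; it is a facet of $\mathcal{P}_\Phi$. For a face $F$ let $V(F)=F\cap\Phi$, let $C(V(F))$ be the set of non-negative rational linear combinations of $V(F)$, let $M(F)=C(V(F))\cap R$ and let $N(F)$ be the $\mathbb{N}$-span of $V(F)$. $F$ is integrally closed in $R$ if $M(F)=N(F)$. *)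

theory Defs
  imports "HOL-Analysis.Analysis" "Graph_Theory.Digraph_Component"
begin

definition refl_root :: "'a::real_inner \<Rightarrow> 'a \<Rightarrow> 'a" where
  "refl_root \<alpha> x = x - (2 * (x \<bullet> \<alpha>) / (\<alpha> \<bullet> \<alpha>)) *\<^sub>R \<alpha>"

definition root_system :: "'a::euclidean_space set \<Rightarrow> bool" where
  "root_system \<Phi> \<longleftrightarrow>
     finite \<Phi> \<and> span \<Phi> = UNIV \<and> 0 \<notin> \<Phi> \<and> (\<forall>\<alpha>\<in>\<Phi>. refl_root \<alpha> ` \<Phi> = \<Phi>)"

definition crystallographic :: "'a::euclidean_space set \<Rightarrow> bool" where
  "crystallographic \<Phi> \<longleftrightarrow> (\<forall>\<alpha>\<in>\<Phi>. \<forall>\<beta>\<in>\<Phi>. 2 * (\<beta> \<bullet> \<alpha>) / (\<alpha> \<bullet> \<alpha>) \<in> \<int>)"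

definition reduced_roots :: "'a::euclidean_space set \<Rightarrow> bool" where
  "reduced_roots \<Phi> \<longleftrightarrow> (\<forall>\<alpha>\<in>\<Phi>. \<forall>c. c *\<^sub>R \<alpha> \<in> \<Phi> \<longrightarrow> c = 1 \<or> c = -1)"

definition irreducible_roots :: "'a::euclidean_space set \<Rightarrow> bool" where
  "irreducible_roots \<Phi> \<longleftrightarrow> \<Phi> \<noteq> {} \<and>
     \<not> (\<exists>A B. A \<noteq> {} \<and> B \<noteq> {} \<and> A \<union> B = \<Phi> \<and> A \<inter> B = {} \<and>
            (\<forall>a\<in>A. \<forall>b\<in>B. orthogonal a b))"

text \<open>Finite linear combinations of elements of \<open>S\<close> with coefficients in \<open>K\<close>: the
  \<open>\<int>\<close>-span for \<open>K = \<int>\<close>, the \<open>\<nat>\<close>-span for \<open>K = \<nat>\<close>, and the rational cone for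
  \<open>K = {q \<in> \<rat>. 0 \<le> q}\<close>. The empty combination \<open>0\<close> is always included.\<close>

definition lin_combs :: "real set \<Rightarrow> 'a::real_vector set \<Rightarrow> 'a set" where
  "lin_combs K S = {\<Sum>v\<in>T. c v *\<^sub>R v | T c. finite T \<and> T \<subseteq> S \<and> c ` T \<subseteq> K}"

definition root_basis :: "'a::euclidean_space set \<Rightarrow> 'a set \<Rightarrow> bool" where
  "root_basis \<Phi> \<Delta> \<longleftrightarrow> \<Delta> \<subseteq> \<Phi> \<and> independent \<Delta> \<and> span \<Delta> = UNIV \<and>
     (\<forall>\<beta>\<in>\<Phi>. \<beta> \<in> lin_combs \<nat> \<Delta> \<or> - \<beta> \<in> lin_combs \<nat> \<Delta>)"

text \<open>\<open>\<theta>\<close> is the greatest root for the order in which \<open>\<beta> \<le> \<theta>\<close> means that \<open>\<theta> - \<beta>\<close> is a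
  non-negative integral combination of simple roots. It exists and is unique when \<open>\<Phi>\<close> is
  irreducible.\<close>

definition highest_root :: "'a::euclidean_space set \<Rightarrow> 'a set \<Rightarrow> 'a" where
  "highest_root \<Phi> \<Delta> = (THE \<theta>. \<theta> \<in> \<Phi> \<and> (\<forall>\<beta>\<in>\<Phi>. \<theta> - \<beta> \<in> lin_combs \<nat> \<Delta>))"

definition coweight :: "'a::euclidean_space set \<Rightarrow> 'a \<Rightarrow> 'a" where
  "coweight \<Delta> \<alpha> = (THE w. \<forall>\<beta>\<in>\<Delta>. w \<bullet> \<beta> = (if \<beta> = \<alpha> then 1 else 0))"

definition root_lattice :: "'a::euclidean_space set \<Rightarrow> 'a set" where
  "root_lattice \<Phi> = lin_combs \<int> \<Phi>"

definition root_polytope :: "'a::euclidean_space set \<Rightarrow> 'a set" where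
  "root_polytope \<Phi> = convex hull \<Phi>"

text \<open>The underlying simple graph of the extended Dynkin diagram, with the extra node given by
  \<open>- \<theta>\<close>. Edge multiplicities and arrows are omitted because only connectedness is used.\<close>

definition affine_dynkin :: "'a::euclidean_space set \<Rightarrow> 'a set \<Rightarrow> ('a, 'a \<times> 'a) pre_digraph" where
  "affine_dynkin \<Phi> \<Delta> =
     (let V = insert (- highest_root \<Phi> \<Delta>) \<Delta> in
      \<lparr> verts = V, arcs = {(\<beta>, \<gamma>) \<in> V \<times> V. \<beta> \<noteq> \<gamma> \<and> \<not> orthogonal \<beta> \<gamma>},
        tail = fst, head = snd \<rparr>)"

definition maximal_root :: "'a::euclidean_space set \<Rightarrow> 'a set \<Rightarrow> 'a \<Rightarrow> bool" where
  "maximal_root \<Phi> \<Delta> \<alpha> \<longleftrightarrow>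
     Digraph_Component.connected
       (affine_dynkin \<Phi> \<Delta> \<restriction> (verts (affine_dynkin \<Phi> \<Delta>) - {\<alpha>}))"

definition root_facet :: "'a::euclidean_space set \<Rightarrow> 'a set \<Rightarrow> 'a \<Rightarrow> 'a set" where
  "root_facet \<Phi> \<Delta> \<alpha> =
     {u \<in> root_polytope \<Phi>. coweight \<Delta> \<alpha> \<bullet> u = coweight \<Delta> \<alpha> \<bullet> highest_root \<Phi> \<Delta>}"

definition face_roots :: "'a::euclidean_space set \<Rightarrow> 'a set \<Rightarrow> 'a set" where
  "face_roots \<Phi> F = F \<inter> \<Phi>"

definition face_cone :: "'a::euclidean_space set \<Rightarrow> 'a set \<Rightarrow> 'a set" where
  "face_cone \<Phi> F = lin_combs {q \<in> \<rat>. 0 \<le> q} (face_roots \<Phi> F)"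

text \<open>\<open>M(F) = N(F)\<close>: the lattice points of the rational cone over \<open>V(F) = F \<inter> \<Phi>\<close> are exactly the
  \<open>\<nat>\<close>-combinations of \<open>V(F)\<close>.\<close>

definition integrally_closed :: "'a::euclidean_space set \<Rightarrow> 'a set \<Rightarrow> bool" where
  "integrally_closed \<Phi> F \<longleftrightarrow>
     face_cone \<Phi> F \<inter> root_lattice \<Phi> = lin_combs \<nat> (face_roots \<Phi> F)"

end

theory Submission
  imports Defs
begin

text \<open>Let \<open>m\<close> be the coefficient of \<open>\<alpha>\<close> in \<open>\<theta>\<close>; then \<open>V\<close>, the set of roots in the facet, consists of
  the roots of level \<open>m\<close>, i.e. those with \<open>\<alpha>\<close>-coefficient \<open>m\<close>. The lattice points of level \<open>k m\<close> in
  its cone are always sums of \<open>k\<close> elements of \<open>V\<close>: reflections in the simple roots other than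
  \<open>\<alpha>\<close> permute \<open>V\<close>, so one may assume the point dominant for them, and then it is reached from
  \<open>k \<theta>\<close> by subtracting simple roots. The only obstruction is thus the existence of lattice points
  whose level is not a multiple of \<open>m\<close>. There are none if \<open>m = 1\<close>. Conversely, maximality of \<open>\<alpha>\<close>
  lets the rational span of \<open>V\<close> spread from \<open>- \<theta>\<close> along the extended Dynkin diagram to all
  simple roots, so that \<open>\<alpha>\<close> plus a large multiple of the sum of \<open>V\<close> lies in the cone, and its
  level is \<open>1\<close> modulo \<open>m\<close>.\<close>

subsection \<open>Linear combinations and reflections\<close>

text \<open>Padding coefficients by zero outside the support puts all combinations on one index set,
  so that they can be added and scaled coefficientwise.\<close>

lemma lin_combs_finite:
  assumes "finite S" "0 \<in> K"
  shows "lin_combs K S = {\<Sum>v\<in>S. c v *\<^sub>R v | c. c ` S \<subseteq> K}"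
proof (intro equalityI subsetI)
  fix x assume "x \<in> lin_combs K S"
  then obtain T c where T: "finite T" "T \<subseteq> S" "c ` T \<subseteq> K" and x: "x = (\<Sum>v\<in>T. c v *\<^sub>R v)"
    unfolding lin_combs_def by blast
  have "x = (\<Sum>v\<in>S. (if v \<in> T then c v else 0) *\<^sub>R v)"
    unfolding x using T assms by (intro sum.mono_neutral_cong_left) auto
  moreover have "(\<lambda>v. if v \<in> T then c v else 0) ` S \<subseteq> K"
    using T assms by auto
  ultimately show "x \<in> {\<Sum>v\<in>S. c v *\<^sub>R v | c. c ` S \<subseteq> K}"
    by (intro CollectI exI[of _ "\<lambda>v. if v \<in> T then c v else 0"]) simp
next
  fix x assume "x \<in> {\<Sum>v\<in>S. c v *\<^sub>R v | c. c ` S \<subseteq> K}"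
  then show "x \<in> lin_combs K S"
    unfolding lin_combs_def using assms by blast
qed

lemma lin_combs_mono:
  "K \<subseteq> L \<Longrightarrow> S \<subseteq> T \<Longrightarrow> lin_combs K S \<subseteq> lin_combs L T"
  unfolding lin_combs_def by (intro subsetI) (smt (verit) mem_Collect_eq order_trans)

lemma lin_combs_add:
  assumes S: "finite S" and 0: "0 \<in> K" and add: "\<And>a b. a \<in> K \<Longrightarrow> b \<in> K \<Longrightarrow> a + b \<in> K"
    and x: "x \<in> lin_combs K S" and y: "y \<in> lin_combs K S"
  shows "x + y \<in> lin_combs K S"
proof -
  obtain c d where "c ` S \<subseteq> K" "x = (\<Sum>v\<in>S. c v *\<^sub>R v)" "d ` S \<subseteq> K" "y = (\<Sum>v\<in>S. d v *\<^sub>R v)"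
    using x y unfolding lin_combs_finite[OF S 0] by auto
  then show ?thesis
    unfolding lin_combs_finite[OF S 0]
    by (intro CollectI exI[of _ "\<lambda>v. c v + d v"]) (auto simp: scaleR_add_left sum.distrib intro: add)
qed

lemma lin_combs_sum:
  assumes S: "finite S" and 0: "0 \<in> K" and add: "\<And>a b. a \<in> K \<Longrightarrow> b \<in> K \<Longrightarrow> a + b \<in> K"
    and f: "\<And>i. i \<in> I \<Longrightarrow> f i \<in> lin_combs K S"
  shows "sum f I \<in> lin_combs K S"
proof -
  have "0 \<in> lin_combs K S"
    unfolding lin_combs_def by (intro CollectI exI[of _ "{}"]) auto
  then show ?thesis
    using f by (induction I rule: infinite_finite_induct) (auto intro: lin_combs_add[OF S 0 add])
qed

lemma lin_combs_scale:
  assumes S: "finite S" and 0: "0 \<in> K" and mult: "\<And>b. b \<in> K \<Longrightarrow> a * b \<in> K"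
    and x: "x \<in> lin_combs K S"
  shows "a *\<^sub>R x \<in> lin_combs K S"
proof -
  obtain c where "c ` S \<subseteq> K" "x = (\<Sum>v\<in>S. c v *\<^sub>R v)"
    using x unfolding lin_combs_finite[OF S 0] by auto
  then show ?thesis
    unfolding lin_combs_finite[OF S 0]
    by (intro CollectI exI[of _ "\<lambda>v. a * c v"]) (auto simp: scaleR_sum_right intro: mult)
qed

lemma lin_combs_base:
  "v \<in> S \<Longrightarrow> 1 \<in> K \<Longrightarrow> v \<in> lin_combs K S"
  unfolding lin_combs_def by (intro CollectI exI[of _ "{v}"] exI[of _ "\<lambda>_. 1"]) auto

lemma Nats_nonneg: "x \<in> \<nat> \<Longrightarrow> (0::real) \<le> x"
  by (erule Nats_cases) simp

lemma sum_in_Nats: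
  "(\<And>i. i \<in> I \<Longrightarrow> f i \<in> \<nat>) \<Longrightarrow> sum f I \<in> (\<nat> :: 'a::semiring_1 set)"
  by (induction I rule: infinite_finite_induct) auto

lemma linear_refl_root: "linear (refl_root \<beta>)"
  by (rule linearI) (simp_all add: refl_root_def inner_add_left algebra_simps add_divide_distrib)

lemma refl_root_refl_root: "refl_root \<beta> (refl_root \<beta> x) = x"
proof (cases "\<beta> = 0")
  case False
  then have "refl_root \<beta> x \<bullet> \<beta> = - (x \<bullet> \<beta>)"
    by (simp add: refl_root_def inner_diff_left)
  then have "refl_root \<beta> (refl_root \<beta> x) = refl_root \<beta> x + (2 * (x \<bullet> \<beta>) / (\<beta> \<bullet> \<beta>)) *\<^sub>R \<beta>"
    by (subst refl_root_def) simp
  then show ?thesis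
    by (simp add: refl_root_def)
qed (simp add: refl_root_def)

subsection \<open>Root systems with a basis\<close>

locale based_root_system =
  fixes \<Phi> \<Delta> :: "'a::euclidean_space set"
  assumes root_system: "root_system \<Phi>" and crystallographic: "crystallographic \<Phi>"
    and reduced: "reduced_roots \<Phi>" and basis: "root_basis \<Phi> \<Delta>"
begin

abbreviation coef :: "'a \<Rightarrow> 'a \<Rightarrow> real" where
  "coef \<gamma> x \<equiv> coweight \<Delta> \<gamma> \<bullet> x"

abbreviation Qplus :: "'a set" where
  "Qplus \<equiv> lin_combs \<nat> \<Delta>"

text \<open>Takes natural values on \<open>Qplus\<close>, so it serves as the measure for the
  inductions below.\<close>

definition ht :: "'a \<Rightarrow> real" where
  "ht x = (\<Sum>\<gamma>\<in>\<Delta>. coef \<gamma> x)"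

lemma finite_roots: "finite \<Phi>" and zero_not_root: "0 \<notin> \<Phi>"
  using root_system by (auto simp: root_system_def)

lemma simple_root: "\<gamma> \<in> \<Delta> \<Longrightarrow> \<gamma> \<in> \<Phi>" and span_simple: "span \<Delta> = UNIV"
  using basis by (auto simp: root_basis_def)

lemma finite_simple: "finite \<Delta>"
  using simple_root by (intro finite_subset[OF _ finite_roots] subsetI)

lemma refl_root_mem: "\<beta> \<in> \<Phi> \<Longrightarrow> \<gamma> \<in> \<Phi> \<Longrightarrow> refl_root \<beta> \<gamma> \<in> \<Phi>"
  using root_system unfolding root_system_def by blast

lemma neg_root:
  assumes "\<beta> \<in> \<Phi>" shows "- \<beta> \<in> \<Phi>"
proof -
  have "\<beta> \<noteq> 0"
    using assms zero_not_root by auto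
  then have "refl_root \<beta> \<beta> = - \<beta>"
    by (simp add: refl_root_def scaleR_2)
  then show ?thesis
    using refl_root_mem[OF assms assms] by simp
qed

text \<open>The two Cartan integers of the pair are positive, and strict Cauchy-Schwarz bounds their
  product below 4. Hence one of them is 1, and the matching reflection produces the difference or
  its negative.\<close>

lemma diff_root:
  assumes \<beta>: "\<beta> \<in> \<Phi>" and \<gamma>: "\<gamma> \<in> \<Phi>" and pos: "\<beta> \<bullet> \<gamma> > 0" and neq: "\<beta> \<noteq> \<gamma>"
  shows "\<beta> - \<gamma> \<in> \<Phi>"
proof -
  have nz: "\<beta> \<noteq> 0" "\<gamma> \<noteq> 0"
    using pos by auto
  obtain i j :: int where i: "2 * (\<beta> \<bullet> \<gamma>) / (\<gamma> \<bullet> \<gamma>) = of_int i"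
    and j: "2 * (\<gamma> \<bullet> \<beta>) / (\<beta> \<bullet> \<beta>) = of_int j"
    using crystallographic \<beta> \<gamma> unfolding crystallographic_def by (meson Ints_cases)
  \<comment> \<open>Equality in Cauchy-Schwarz would make \<beta> a positive multiple of \<gamma>,
    which reducedness turns into \<beta> = \<gamma>.\<close>
  have "norm \<beta> *\<^sub>R \<gamma> \<noteq> norm \<gamma> *\<^sub>R \<beta>"
  proof
    assume "norm \<beta> *\<^sub>R \<gamma> = norm \<gamma> *\<^sub>R \<beta>"
    then have "(1 / norm \<gamma>) *\<^sub>R (norm \<beta> *\<^sub>R \<gamma>) = (1 / norm \<gamma>) *\<^sub>R (norm \<gamma> *\<^sub>R \<beta>)"
      by simp
    then have eq: "(norm \<beta> / norm \<gamma>) *\<^sub>R \<gamma> = \<beta>"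
      using nz by simp
    then have "norm \<beta> / norm \<gamma> = 1 \<or> norm \<beta> / norm \<gamma> = -1"
      using reduced \<beta> \<gamma> unfolding reduced_roots_def by metis
    moreover have "norm \<beta> / norm \<gamma> > 0"
      using nz by simp
    ultimately show False
      using eq neq by (metis less_minus_one_simps(1) order_less_asym scaleR_one)
  qed
  then have "\<beta> \<bullet> \<gamma> < norm \<beta> * norm \<gamma>"
    using norm_cauchy_schwarz[of \<beta> \<gamma>] norm_cauchy_schwarz_eq[of \<beta> \<gamma>] by linarith
  then have "(\<beta> \<bullet> \<gamma>)\<^sup>2 < (norm \<beta> * norm \<gamma>)\<^sup>2"
    using pos by (intro power_strict_mono) auto
  then have cs: "(\<beta> \<bullet> \<gamma>)\<^sup>2 < (\<beta> \<bullet> \<beta>) * (\<gamma> \<bullet> \<gamma>)"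
    by (simp add: power_mult_distrib power2_norm_eq_inner)
  have "of_int i * of_int j = 4 * (\<beta> \<bullet> \<gamma>)\<^sup>2 / ((\<beta> \<bullet> \<beta>) * (\<gamma> \<bullet> \<gamma>))"
    unfolding i[symmetric] j[symmetric] by (simp add: power2_eq_square inner_commute mult.commute)
  also have "\<dots> < 4"
    using cs nz by (simp add: divide_less_eq)
  finally have "real_of_int (i * j) < real_of_int 4"
    by simp
  then have ij: "i * j < 4"
    by linarith
  have "real_of_int i > 0" "real_of_int j > 0"
    unfolding i[symmetric] j[symmetric] using pos nz by (simp_all add: inner_commute)
  then have "i \<ge> 1" "j \<ge> 1"
    by simp_all
  \<comment> \<open>If both integers were at least 2, their product would be at least 4.\<close>
  then have "i = 1 \<or> j = 1"
    using ij mult_mono[of 2 i 2 j] by linarith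
  then show ?thesis
  proof
    assume "i = 1"
    then show ?thesis
      using refl_root_mem[OF \<gamma> \<beta>] i by (simp add: refl_root_def)
  next
    assume "j = 1"
    then show ?thesis
      using neg_root[OF refl_root_mem[OF \<beta> \<gamma>]] j by (simp add: refl_root_def)
  qed
qed

section \<open>Coordinates with respect to the simple roots, and height\<close>

lemma coef_simple:
  assumes "\<gamma> \<in> \<Delta>" "\<delta> \<in> \<Delta>"
  shows "coef \<gamma> \<delta> = (if \<delta> = \<gamma> then 1 else 0)"
proof -
  let ?P = "\<lambda>w. \<forall>\<beta>\<in>\<Delta>. w \<bullet> \<beta> = (if \<beta> = \<gamma> then 1 else 0 :: real)"
  have "independent \<Delta>"
    using basis by (simp add: root_basis_def)
  then obtain f :: "'a \<Rightarrow> real" where f: "linear f" "\<forall>\<beta>\<in>\<Delta>. f \<beta> = (if \<beta> = \<gamma> then 1 else 0)"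
    using linear_independent_extend[of \<Delta> "\<lambda>\<beta>. if \<beta> = \<gamma> then 1 else 0 :: real"] by blast
  \<comment> \<open>The adjoint turns the functional dual to \<gamma> into a vector. Uniqueness
    follows because the simple roots span; both are needed to evaluate the definite
    description.\<close>
  have "?P (adjoint f 1)"
    using f adjoint_works[OF f(1), of _ 1] by (simp add: inner_commute)
  moreover have "w = w'" if "?P w" "?P w'" for w w'
  proof -
    have "orthogonal (w - w') \<beta>" if "\<beta> \<in> \<Delta>" for \<beta>
      using \<open>?P w\<close> \<open>?P w'\<close> that by (simp add: orthogonal_def inner_diff_left)
    then have "orthogonal (w - w') (w - w')"
      using orthogonal_to_span[of "w - w'" \<Delta> "w - w'"] span_simple by auto
    then show ?thesis
      by (simp add: orthogonal_def)
  qed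
  ultimately have "?P (coweight \<Delta> \<gamma>)"
    unfolding coweight_def by (intro theI[where P = ?P]) blast+
  then show ?thesis
    using assms by auto
qed

lemma coef_sum:
  assumes "\<gamma> \<in> \<Delta>"
  shows "coef \<gamma> (\<Sum>\<delta>\<in>\<Delta>. a \<delta> *\<^sub>R \<delta>) = a \<gamma>"
proof -
  have "coef \<gamma> (\<Sum>\<delta>\<in>\<Delta>. a \<delta> *\<^sub>R \<delta>) = (\<Sum>\<delta>\<in>\<Delta>. if \<delta> = \<gamma> then a \<delta> else 0)"
    unfolding inner_sum_right using coef_simple[OF assms] by (intro sum.cong) auto
  then show ?thesis
    using assms finite_simple by simp
qed

lemma coef_expansion: "x = (\<Sum>\<gamma>\<in>\<Delta>. coef \<gamma> x *\<^sub>R \<gamma>)"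
proof -
  have "x \<in> span \<Delta>"
    using span_simple by auto
  then obtain a where x: "x = (\<Sum>\<delta>\<in>\<Delta>. a \<delta> *\<^sub>R \<delta>)"
    unfolding span_finite[OF finite_simple] by auto
  show ?thesis
    by (subst x, rule sum.cong) (auto simp: x coef_sum)
qed

lemma inner_coef_expansion: "y \<bullet> x = (\<Sum>\<gamma>\<in>\<Delta>. coef \<gamma> x * (y \<bullet> \<gamma>))"
  by (subst coef_expansion[of x]) (simp add: inner_sum_right)

lemma lin_combs_simple_iff:
  assumes "0 \<in> K"
  shows "x \<in> lin_combs K \<Delta> \<longleftrightarrow> (\<forall>\<gamma>\<in>\<Delta>. coef \<gamma> x \<in> K)"
proof
  assume "x \<in> lin_combs K \<Delta>"
  then obtain c where "c ` \<Delta> \<subseteq> K" "x = (\<Sum>\<gamma>\<in>\<Delta>. c \<gamma> *\<^sub>R \<gamma>)"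
    unfolding lin_combs_finite[OF finite_simple assms] by auto
  then show "\<forall>\<gamma>\<in>\<Delta>. coef \<gamma> x \<in> K"
    using coef_sum by auto
next
  assume "\<forall>\<gamma>\<in>\<Delta>. coef \<gamma> x \<in> K"
  then show "x \<in> lin_combs K \<Delta>"
    unfolding lin_combs_finite[OF finite_simple assms]
    by (intro CollectI exI[of _ "\<lambda>\<gamma>. coef \<gamma> x"] conjI coef_expansion) auto
qed

lemma Qplus_iff: "x \<in> Qplus \<longleftrightarrow> (\<forall>\<gamma>\<in>\<Delta>. coef \<gamma> x \<in> \<nat>)"
  by (rule lin_combs_simple_iff) simp

lemma Qplus_add: "x \<in> Qplus \<Longrightarrow> y \<in> Qplus \<Longrightarrow> x + y \<in> Qplus"
  by (auto simp: Qplus_iff inner_add_right)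

lemma simple_Qplus: "\<gamma> \<in> \<Delta> \<Longrightarrow> \<gamma> \<in> Qplus"
  by (auto simp: Qplus_iff coef_simple)

lemma root_Qplus: "\<beta> \<in> \<Phi> \<Longrightarrow> \<beta> \<in> Qplus \<or> - \<beta> \<in> Qplus"
  using basis by (auto simp: root_basis_def)

lemma ht_diff: "ht (x - y) = ht x - ht y"
  by (simp add: ht_def inner_diff_right sum_subtractf)

lemma ht_scaleR: "ht (a *\<^sub>R x) = a * ht x"
  by (simp add: ht_def sum_distrib_left)

lemma ht_simple: "\<gamma> \<in> \<Delta> \<Longrightarrow> ht \<gamma> = 1"
  unfolding ht_def using finite_simple by (simp add: coef_simple)

lemma ht_Nats: "x \<in> Qplus \<Longrightarrow> ht x \<in> \<nat>"
  unfolding ht_def Qplus_iff by (rule sum_in_Nats) blast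

lemma ht_nonneg: "x \<in> Qplus \<Longrightarrow> ht x \<ge> 0"
  by (rule Nats_nonneg[OF ht_Nats])

lemma coef_nonneg: "x \<in> Qplus \<Longrightarrow> \<gamma> \<in> \<Delta> \<Longrightarrow> coef \<gamma> x \<ge> 0"
  unfolding Qplus_iff by (blast intro: Nats_nonneg)

lemma ht_eq_0:
  assumes "x \<in> Qplus" "ht x = 0" shows "x = 0"
proof -
  have "(\<Sum>\<gamma>\<in>\<Delta>. coef \<gamma> x) = 0"
    using assms(2) by (simp only: ht_def)
  then have "\<forall>\<gamma>\<in>\<Delta>. coef \<gamma> x = 0"
    using sum_nonneg_eq_0_iff[OF finite_simple coef_nonneg[OF assms(1)]] by simp
  then show ?thesis
    by (subst coef_expansion[of x]) simp
qed

lemma Qplus_antisym: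
  assumes "x \<in> Qplus" "- x \<in> Qplus" shows "x = 0"
  using assms ht_nonneg[of x] ht_nonneg[of "- x"] ht_diff[of 0 x]
  by (intro ht_eq_0) (auto simp: ht_def)

text \<open>The heights of \<open>x\<close> and \<open>\<gamma> - x\<close> are natural numbers with
  sum 1, so one of them is 0 and the corresponding vector vanishes.\<close>

lemma Qplus_below_simple:
  assumes "\<gamma> \<in> \<Delta>" "x \<in> Qplus" "\<gamma> - x \<in> Qplus"
  shows "x = 0 \<or> x = \<gamma>"
proof -
  obtain m n where mn: "ht x = of_nat m" "ht (\<gamma> - x) = of_nat n"
    using assms ht_Nats by (meson Nats_cases)
  then have "real (m + n) = 1"
    using ht_diff[of \<gamma> x] ht_simple[OF assms(1)] by simp
  then have "m + n = 1"
    by linarith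
  then have "m = 0 \<or> n = 0"
    by linarith
  then show ?thesis
    using mn ht_eq_0[OF assms(2)] ht_eq_0[OF assms(3)] by auto
qed

text \<open>Otherwise \<open>\<gamma> - \<delta>\<close> would be a root, yet its coefficients have
  both signs.\<close>

lemma inner_simple_nonpos:
  assumes "\<gamma> \<in> \<Delta>" "\<delta> \<in> \<Delta>" "\<gamma> \<noteq> \<delta>"
  shows "\<gamma> \<bullet> \<delta> \<le> 0"
proof (rule ccontr)
  assume "\<not> ?thesis"
  then have "\<gamma> - \<delta> \<in> \<Phi>"
    using assms by (intro diff_root simple_root) auto
  then have "\<gamma> - \<delta> \<in> Qplus \<or> \<delta> - \<gamma> \<in> Qplus"
    using root_Qplus[of "\<gamma> - \<delta>"] by simp
  then show False
    using Qplus_below_simple[of \<gamma> \<delta>] Qplus_below_simple[of \<delta> \<gamma>] assms simple_Qplus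
      simple_root zero_not_root by metis
qed

text \<open>Removing a simple root from a positive root keeps it in one orthogonal component; a removed
  root from the other component would produce a reflected root with coefficients of both signs.\<close>

lemma positive_root_in_component:
  assumes D: "\<Delta> = D\<^sub>1 \<union> D\<^sub>2" and orth: "\<And>\<gamma> \<delta>. \<gamma> \<in> D\<^sub>1 \<Longrightarrow> \<delta> \<in> D\<^sub>2 \<Longrightarrow> orthogonal \<gamma> \<delta>"
    and \<beta>: "\<beta> \<in> \<Phi>" "\<beta> \<in> Qplus"
  shows "\<beta> \<in> span D\<^sub>1 \<or> \<beta> \<in> span D\<^sub>2"
proof -
  obtain n where "ht \<beta> = of_nat n"
    using ht_Nats[OF \<beta>(2)] by (auto elim: Nats_cases)
  then show ?thesis
    using \<beta>
  proof (induction n arbitrary: \<beta>)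
    case 0
    then show ?case
      using ht_eq_0[of \<beta>] span_zero by auto
  next
    case (Suc n)
    note \<beta> = Suc.prems(2,3)
    show ?case
    proof (cases "\<beta> \<in> \<Delta>")
      case True
      then show ?thesis
        using D span_base by blast
    next
      case False
      \<comment> \<open>Expanding this square over the simple roots exhibits a constituent \<gamma>
        of \<beta> with positive product, which can be subtracted within the roots.\<close>
      have "\<beta> \<bullet> \<beta> > 0"
        using \<beta> zero_not_root by auto
      then have "(\<Sum>\<gamma>\<in>\<Delta>. coef \<gamma> \<beta> * (\<beta> \<bullet> \<gamma>)) > 0"
        using inner_coef_expansion[of \<beta> \<beta>] by simp
      then obtain \<gamma> where \<gamma>: "\<gamma> \<in> \<Delta>" "coef \<gamma> \<beta> * (\<beta> \<bullet> \<gamma>) > 0"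
        by (meson not_less sum_nonpos)
      moreover have "coef \<gamma> \<beta> \<ge> 0"
        using \<beta> \<gamma> coef_nonneg by blast
      ultimately have pos: "\<beta> \<bullet> \<gamma> > 0"
        by (simp add: zero_less_mult_iff)
      have r: "\<beta> - \<gamma> \<in> \<Phi>"
        using \<beta> \<gamma> pos False by (intro diff_root) (auto intro: simple_root)
      have "\<gamma> - \<beta> \<notin> Qplus"
        using Qplus_below_simple[OF \<gamma>(1) \<beta>(2)] False \<gamma> \<beta> zero_not_root by auto
      then have q: "\<beta> - \<gamma> \<in> Qplus"
        using root_Qplus[OF r] by auto
      have "ht (\<beta> - \<gamma>) = of_nat n"
        using Suc.prems(1) ht_simple[OF \<gamma>(1)] by (simp add: ht_diff)
      note IH = Suc.IH[OF this r q]
      \<comment> \<open>Stated for a general \<open>A\<close> so that it serves both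
        components.\<close>
      have key: "\<beta> \<in> span A" if A: "\<beta> - \<gamma> \<in> span A" "A \<subseteq> \<Delta>" and o: "\<gamma> \<notin> A \<Longrightarrow> \<forall>\<delta>\<in>A. orthogonal \<gamma> \<delta>" for A
      proof (cases "\<gamma> \<in> A")
        case True
        then have "(\<beta> - \<gamma>) + \<gamma> \<in> span A"
          using A span_add span_base by blast
        then show ?thesis
          by simp
      next
        case False
        have "orthogonal \<gamma> (\<beta> - \<gamma>)"
          using o[OF False] orthogonal_to_span[OF A(1), of \<gamma>] by blast
        then have "\<beta> \<bullet> \<gamma> = \<gamma> \<bullet> \<gamma>"
          by (simp add: orthogonal_def inner_diff_right inner_commute)
        then have "refl_root \<gamma> \<beta> = (\<beta> - \<gamma>) - \<gamma>"
          using pos by (simp add: refl_root_def scaleR_2)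
        then have root: "(\<beta> - \<gamma>) - \<gamma> \<in> \<Phi>"
          using refl_root_mem[OF simple_root[OF \<gamma>(1)] \<beta>(1)] by simp
        have "\<forall>\<delta>\<in>A. orthogonal (coweight \<Delta> \<gamma>) \<delta>"
          using A(2) False \<gamma>(1) coef_simple by (auto simp: orthogonal_def)
        then have "orthogonal (coweight \<Delta> \<gamma>) (\<beta> - \<gamma>)"
          using orthogonal_to_span[OF A(1), of "coweight \<Delta> \<gamma>"] by blast
        then have c0: "coef \<gamma> (\<beta> - \<gamma>) = 0"
          by (simp add: orthogonal_def)
        then have "coef \<gamma> ((\<beta> - \<gamma>) - \<gamma>) = - 1"
          using coef_simple[OF \<gamma>(1) \<gamma>(1)] inner_diff_right[of _ "\<beta> - \<gamma>"] by simp
        then have "(\<beta> - \<gamma>) - \<gamma> \<notin> Qplus"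
          using \<gamma>(1) coef_nonneg by fastforce
        \<comment> \<open>Having coefficient -1 at \<gamma>, the reflected root is negative. This
          puts \<open>\<beta> - \<gamma>\<close> below the simple root \<gamma>, so it is 0 or
          \<gamma>: the first is no root, the second contradicts its vanishing
          \<gamma>-coefficient.\<close>
        then have "\<gamma> - (\<beta> - \<gamma>) \<in> Qplus"
          using root_Qplus[OF root] by simp
        then have "\<beta> - \<gamma> = 0 \<or> \<beta> - \<gamma> = \<gamma>"
          using Qplus_below_simple[OF \<gamma>(1) q] by simp
        then show ?thesis
          using c0 coef_simple[OF \<gamma>(1) \<gamma>(1)] r zero_not_root by auto
      qed
      show ?thesis
        using IH
      proof
        assume "\<beta> - \<gamma> \<in> span D\<^sub>1"
        then have "\<beta> \<in> span D\<^sub>1"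
          using D orth \<gamma>(1) orthogonal_commute by (intro key) blast+
        then show ?thesis ..
      next
        assume "\<beta> - \<gamma> \<in> span D\<^sub>2"
        then have "\<beta> \<in> span D\<^sub>2"
          using D orth \<gamma>(1) orthogonal_commute by (intro key) blast+
        then show ?thesis ..
      qed
    qed
  qed
qed

section \<open>Maximal elements of the root order\<close>

definition maximal_elem :: "'a \<Rightarrow> bool" where
  "maximal_elem \<theta> \<longleftrightarrow> \<theta> \<in> \<Phi> \<and> (\<forall>\<beta>\<in>\<Phi>. \<beta> - \<theta> \<in> Qplus \<longrightarrow> \<beta> = \<theta>)"

text \<open>If \<theta> were negative, the root \<open>- \<theta>\<close> would lie above
  it.\<close>

lemma maximal_elem_Qplus:
  assumes "maximal_elem \<theta>" shows "\<theta> \<in> Qplus"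
proof (rule ccontr)
  assume "\<theta> \<notin> Qplus"
  then have "- \<theta> \<in> Qplus"
    using assms root_Qplus by (auto simp: maximal_elem_def)
  then have "- \<theta> - \<theta> \<in> Qplus"
    using Qplus_add[of "- \<theta>" "- \<theta>"] by simp
  then have "- \<theta> = \<theta>"
    using assms neg_root by (auto simp: maximal_elem_def)
  then show False
    using \<open>- \<theta> \<in> Qplus\<close> \<open>\<theta> \<notin> Qplus\<close> by simp
qed

text \<open>A negative product would make \<open>\<theta> + \<gamma>\<close> a root strictly above
  \<theta>.\<close>

lemma maximal_elem_dominant:
  assumes \<theta>: "maximal_elem \<theta>" and \<gamma>: "\<gamma> \<in> \<Delta>" shows "\<theta> \<bullet> \<gamma> \<ge> 0"
proof (rule ccontr)
  assume neg: "\<not> ?thesis"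
  have "\<theta> \<noteq> - \<gamma>"
    using Qplus_antisym[of \<gamma>] simple_Qplus[OF \<gamma>] maximal_elem_Qplus[OF \<theta>] simple_root[OF \<gamma>] zero_not_root
    by auto
  then have "\<theta> - (- \<gamma>) \<in> \<Phi>"
    using \<theta> simple_root[OF \<gamma>] neg by (intro diff_root neg_root) (auto simp: maximal_elem_def)
  then have "\<theta> + \<gamma> = \<theta>"
    using \<theta> simple_Qplus[OF \<gamma>] unfolding maximal_elem_def by auto
  then show False
    using simple_root[OF \<gamma>] zero_not_root by auto
qed

text \<open>Among the finitely many roots above \<beta>, one of greatest height is maximal. Once
  maximal elements are known to be unique, this makes the maximal element the greatest root.\<close>

lemma maximal_elem_above:
  assumes "\<beta> \<in> \<Phi>"
  obtains \<theta> where "maximal_elem \<theta>" "\<theta> - \<beta> \<in> Qplus"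
proof -
  let ?S = "{\<gamma> \<in> \<Phi>. \<gamma> - \<beta> \<in> Qplus}"
  have "finite (ht ` ?S)" "ht ` ?S \<noteq> {}"
    using assms finite_roots by (auto simp: Qplus_iff intro!: exI[of _ \<beta>])
  then obtain \<theta> where \<theta>: "\<theta> \<in> ?S" and max: "\<forall>\<gamma>\<in>?S. ht \<gamma> \<le> ht \<theta>"
    by (smt (verit, ccfv_threshold) Max_ge Max_in image_iff)
  have "\<gamma> = \<theta>" if \<gamma>: "\<gamma> \<in> \<Phi>" "\<gamma> - \<theta> \<in> Qplus" for \<gamma>
  proof -
    have "(\<gamma> - \<theta>) + (\<theta> - \<beta>) \<in> Qplus"
      using \<gamma> \<theta> by (intro Qplus_add) auto
    then have "ht \<gamma> \<le> ht \<theta>"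
      using max \<gamma> by auto
    then have "ht (\<gamma> - \<theta>) = 0"
      using ht_nonneg[OF \<gamma>(2)] by (simp add: ht_diff)
    then show ?thesis
      using ht_eq_0[OF \<gamma>(2)] by simp
  qed
  then show ?thesis
    using \<theta> that by (auto simp: maximal_elem_def)
qed

end

subsection \<open>The highest root\<close>

locale irreducible_based_root_system = based_root_system +
  assumes irreducible: "irreducible_roots \<Phi>"
begin

text \<open>Every root lies in the span of one of the two parts, so an orthogonal splitting of the
  basis would split the whole root system.\<close>

lemma simple_roots_indecomposable:
  assumes D: "\<Delta> = D\<^sub>1 \<union> D\<^sub>2" and orth: "\<And>\<gamma> \<delta>. \<gamma> \<in> D\<^sub>1 \<Longrightarrow> \<delta> \<in> D\<^sub>2 \<Longrightarrow> orthogonal \<gamma> \<delta>"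
  shows "D\<^sub>1 = {} \<or> D\<^sub>2 = {}"
proof (rule ccontr)
  assume ne: "\<not> ?thesis"
  let ?A = "\<Phi> \<inter> span D\<^sub>1" and ?B = "\<Phi> \<inter> span D\<^sub>2"
  have o: "orthogonal x y" if "x \<in> span D\<^sub>1" "y \<in> span D\<^sub>2" for x y
    using that orthogonal_to_span orthogonal_commute orth by (smt (verit))
  have "x \<in> span D\<^sub>1 \<or> x \<in> span D\<^sub>2" if "x \<in> \<Phi>" for x
    using root_Qplus[OF that] positive_root_in_component[OF D orth that]
      positive_root_in_component[OF D orth neg_root[OF that]] span_neg[of "- x"] by auto
  then have "?A \<union> ?B = \<Phi>"
    by blast
  moreover have "x \<notin> ?A \<inter> ?B" for x
    using o[of x x] zero_not_root by (auto simp: orthogonal_self)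
  then have "?A \<inter> ?B = {}"
    by blast
  moreover have "?A \<noteq> {}" "?B \<noteq> {}"
    using ne D simple_root span_base by (auto simp: ex_in_conv[symmetric])
  moreover have "\<forall>a\<in>?A. \<forall>b\<in>?B. orthogonal a b"
    using o by blast
  ultimately show False
    using irreducible unfolding irreducible_roots_def by metis
qed

text \<open>For \<delta> outside the support, every term in the expansion of
  \<open>\<delta> \<bullet> \<theta>\<close> is nonpositive, while dominance makes the sum
  nonnegative. So all terms vanish, \<delta> is orthogonal to the support, and indecomposability
  leaves no such \<delta>.\<close>

lemma maximal_elem_full_support:
  assumes \<theta>: "maximal_elem \<theta>" and \<gamma>: "\<gamma> \<in> \<Delta>" shows "coef \<gamma> \<theta> > 0"
proof -
  let ?D1 = "{\<gamma> \<in> \<Delta>. coef \<gamma> \<theta> > 0}" and ?D2 = "{\<gamma> \<in> \<Delta>. coef \<gamma> \<theta> = 0}"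
  have nonneg: "coef \<gamma> \<theta> \<ge> 0" if "\<gamma> \<in> \<Delta>" for \<gamma>
    using maximal_elem_Qplus[OF \<theta>] that coef_nonneg by blast
  have "?D1 = {} \<or> ?D2 = {}"
  proof (rule simple_roots_indecomposable)
    show "\<Delta> = ?D1 \<union> ?D2"
      using nonneg by force
  next
    fix \<gamma> \<delta> assume \<gamma>: "\<gamma> \<in> ?D1" and \<delta>: "\<delta> \<in> ?D2"
    have le: "coef \<beta> \<theta> * (\<delta> \<bullet> \<beta>) \<le> 0" if "\<beta> \<in> \<Delta>" for \<beta>
      using inner_simple_nonpos[of \<delta> \<beta>] nonneg[OF that] that \<delta>
      by (cases "\<beta> = \<delta>") (auto simp: mult_nonneg_nonpos)
    have "(\<Sum>\<beta>\<in>\<Delta>. coef \<beta> \<theta> * (\<delta> \<bullet> \<beta>)) \<ge> 0"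
      using maximal_elem_dominant[OF \<theta>, of \<delta>] \<delta> inner_coef_expansion[of \<delta> \<theta>]
      by (simp add: inner_commute)
    then have "(\<Sum>\<beta>\<in>\<Delta>. - (coef \<beta> \<theta> * (\<delta> \<bullet> \<beta>))) = 0"
      using sum_nonpos[of \<Delta> "\<lambda>\<beta>. coef \<beta> \<theta> * (\<delta> \<bullet> \<beta>)"] le by (simp add: sum_negf)
    then have "\<forall>\<beta>\<in>\<Delta>. - (coef \<beta> \<theta> * (\<delta> \<bullet> \<beta>)) = 0"
      using le finite_simple by (intro sum_nonneg_eq_0_iff[THEN iffD1]) auto
    then show "orthogonal \<gamma> \<delta>"
      using \<gamma> by (auto simp: orthogonal_def inner_commute)
  qed
  moreover have "?D1 \<noteq> {}"
  proof
    assume "?D1 = {}"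
    then have "\<forall>\<gamma>\<in>\<Delta>. coef \<gamma> \<theta> = 0"
      using nonneg by force
    then have "\<theta> = 0"
      by (subst coef_expansion[of \<theta>]) simp
    then show False
      using \<theta> zero_not_root by (simp add: maximal_elem_def)
  qed
  ultimately show ?thesis
    using \<gamma> nonneg[OF \<gamma>] by force
qed

text \<open>Dominance of \<theta> and full support of \<eta> give
  \<open>\<theta> \<bullet> \<eta> > 0\<close>. If they differed, their difference would then be a
  root, so one would lie above the other.\<close>

lemma maximal_elem_unique:
  assumes \<theta>: "maximal_elem \<theta>" and \<eta>: "maximal_elem \<eta>" shows "\<theta> = \<eta>"
proof (rule ccontr)
  assume neq: "\<theta> \<noteq> \<eta>"
  have roots: "\<theta> \<in> \<Phi>" "\<eta> \<in> \<Phi>"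
    using \<theta> \<eta> by (auto simp: maximal_elem_def)
  have "\<exists>\<gamma>\<in>\<Delta>. \<theta> \<bullet> \<gamma> \<noteq> 0"
  proof (rule ccontr)
    assume "\<not> ?thesis"
    then have "\<theta> \<bullet> \<theta> = 0"
      using inner_coef_expansion[of \<theta> \<theta>] by simp
    then show False
      using roots zero_not_root by simp
  qed
  then obtain \<gamma> where "\<gamma> \<in> \<Delta>" "\<theta> \<bullet> \<gamma> > 0"
    using maximal_elem_dominant[OF \<theta>] by force
  then have "(\<Sum>\<gamma>\<in>\<Delta>. coef \<gamma> \<eta> * (\<theta> \<bullet> \<gamma>)) > 0"
    using maximal_elem_dominant[OF \<theta>] maximal_elem_full_support[OF \<eta>] finite_simple
    by (intro sum_pos2[of _ \<gamma>]) (auto simp: less_imp_le)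
  then have "\<theta> \<bullet> \<eta> > 0"
    using inner_coef_expansion[of \<theta> \<eta>] by simp
  then have "\<theta> - \<eta> \<in> \<Phi>"
    using roots neq by (intro diff_root)
  then have "\<theta> - \<eta> \<in> Qplus \<or> \<eta> - \<theta> \<in> Qplus"
    using root_Qplus by fastforce
  then show False
    using \<theta> \<eta> neq roots by (auto simp: maximal_elem_def)
qed

abbreviation \<theta> :: 'a where
  "\<theta> \<equiv> highest_root \<Phi> \<Delta>"

lemma highest_root: "\<theta> \<in> \<Phi>" and highest_root_ge: "\<beta> \<in> \<Phi> \<Longrightarrow> \<theta> - \<beta> \<in> Qplus"
proof -
  let ?P = "\<lambda>\<theta>. \<theta> \<in> \<Phi> \<and> (\<forall>\<beta>\<in>\<Phi>. \<theta> - \<beta> \<in> Qplus)"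
  obtain \<delta> where "\<delta> \<in> \<Phi>"
    using irreducible by (auto simp: irreducible_roots_def)
  then obtain \<eta> where \<eta>: "maximal_elem \<eta>"
    by (rule maximal_elem_above)
  have "?P \<eta>"
    using \<eta> maximal_elem_unique[OF \<eta>] maximal_elem_above maximal_elem_def by metis
  moreover have "x = y" if "?P x" "?P y" for x y
    using that Qplus_antisym[of "x - y"] by auto
  ultimately have "?P \<theta>"
    unfolding highest_root_def by (intro theI[where P = ?P]) blast+
  then show "\<theta> \<in> \<Phi>" "\<beta> \<in> \<Phi> \<Longrightarrow> \<theta> - \<beta> \<in> Qplus"
    by auto
qed

section \<open>Integrality of coefficients and the root lattice\<close>

lemma root_coef_Ints:
  assumes "\<beta> \<in> \<Phi>" "\<gamma> \<in> \<Delta>" shows "coef \<gamma> \<beta> \<in> \<int>"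
proof -
  have "coef \<gamma> \<beta> \<in> \<nat> \<or> - coef \<gamma> \<beta> \<in> \<nat>"
    using root_Qplus[OF assms(1)] assms(2) by (auto simp: Qplus_iff)
  then show ?thesis
    using Nats_subset_Ints minus_in_Ints_iff by blast
qed

lemma root_lattice_iff: "x \<in> root_lattice \<Phi> \<longleftrightarrow> (\<forall>\<gamma>\<in>\<Delta>. coef \<gamma> x \<in> \<int>)"
proof
  assume "x \<in> root_lattice \<Phi>"
  then obtain c where c: "c ` \<Phi> \<subseteq> \<int>" and x: "x = (\<Sum>\<beta>\<in>\<Phi>. c \<beta> *\<^sub>R \<beta>)"
    unfolding root_lattice_def lin_combs_finite[OF finite_roots Ints_0] by auto
  have "(\<Sum>\<beta>\<in>\<Phi>. c \<beta> * coef \<gamma> \<beta>) \<in> \<int>" if "\<gamma> \<in> \<Delta>" for \<gamma>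
    using c that by (intro Ints_sum Ints_mult root_coef_Ints) auto
  then show "\<forall>\<gamma>\<in>\<Delta>. coef \<gamma> x \<in> \<int>"
    by (simp add: x inner_sum_right)
next
  assume "\<forall>\<gamma>\<in>\<Delta>. coef \<gamma> x \<in> \<int>"
  then have "x \<in> lin_combs \<int> \<Delta>"
    by (simp add: lin_combs_simple_iff)
  then show "x \<in> root_lattice \<Phi>"
    unfolding root_lattice_def using lin_combs_mono[of \<int> \<int> \<Delta> \<Phi>] simple_root by blast
qed

end

subsection \<open>The roots in the facet of a simple root\<close>

locale based_root_system_node = irreducible_based_root_system +
  fixes \<alpha> :: 'a
  assumes \<alpha>: "\<alpha> \<in> \<Delta>"
begin

abbreviation m :: real where
  "m \<equiv> coef \<alpha> \<theta>"

abbreviation V :: "'a set" where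
  "V \<equiv> {\<beta> \<in> \<Phi>. coef \<alpha> \<beta> = m}"

text \<open>An indexed family, with repetitions allowed, lets a single summand be replaced while the
  number of summands stays \<open>k\<close>.\<close>

definition level_sums :: "nat \<Rightarrow> 'a set" where
  "level_sums k = {\<Sum>i<k. f i | f. f ` {..<k} \<subseteq> V}"

lemma face_roots_facet: "face_roots \<Phi> (root_facet \<Phi> \<Delta> \<alpha>) = V"
  by (auto simp: face_roots_def root_facet_def root_polytope_def hull_inc)

lemma finite_V: "finite V"
  using finite_roots by simp

lemma m_Ints: "m \<in> \<int>" and m_ge_1: "m \<ge> 1"
proof -
  show "m \<in> \<int>"
    using highest_root \<alpha> by (rule root_coef_Ints)
  have "coef \<alpha> (\<theta> - \<alpha>) \<ge> 0"
    using highest_root_ge[OF simple_root[OF \<alpha>]] \<alpha> by (rule coef_nonneg)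
  then show "m \<ge> 1"
    using coef_simple[OF \<alpha> \<alpha>] by (simp add: inner_diff_right)
qed

section \<open>Reflections and sums of facet roots\<close>

lemma coef_refl_root:
  "\<beta> \<in> \<Delta> \<Longrightarrow> \<beta> \<noteq> \<alpha> \<Longrightarrow> coef \<alpha> (refl_root \<beta> x) = coef \<alpha> x"
  by (simp add: refl_root_def inner_diff_right coef_simple \<alpha>)

lemma refl_root_V: "\<beta> \<in> \<Delta> \<Longrightarrow> \<beta> \<noteq> \<alpha> \<Longrightarrow> v \<in> V \<Longrightarrow> refl_root \<beta> v \<in> V"
  using refl_root_mem[OF simple_root] coef_refl_root by auto

lemma coef_level_sums: "x \<in> level_sums k \<Longrightarrow> coef \<alpha> x = k * m"
proof -
  assume "x \<in> level_sums k"
  then obtain f where f: "f ` {..<k} \<subseteq> V" "x = (\<Sum>i<k. f i)"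
    unfolding level_sums_def by auto
  have "coef \<alpha> x = (\<Sum>i<k. m)"
    unfolding f(2) inner_sum_right using f(1) by (intro sum.cong) auto
  then show ?thesis
    by simp
qed

lemma level_sums_refl_root:
  assumes "x \<in> level_sums k" "\<beta> \<in> \<Delta>" "\<beta> \<noteq> \<alpha>" shows "refl_root \<beta> x \<in> level_sums k"
proof -
  obtain f where f: "f ` {..<k} \<subseteq> V" "x = (\<Sum>i<k. f i)"
    using assms(1) unfolding level_sums_def by auto
  have "refl_root \<beta> x = (\<Sum>i<k. refl_root \<beta> (f i))"
    unfolding f(2) by (rule linear_sum[OF linear_refl_root])
  moreover have "(\<lambda>i. refl_root \<beta> (f i)) ` {..<k} \<subseteq> V"
    using f(1) refl_root_V[OF assms(2,3)] by blast
  ultimately show ?thesis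
    unfolding level_sums_def by (intro CollectI exI[of _ "\<lambda>i. refl_root \<beta> (f i)"] conjI)
qed

text \<open>Some summand has positive product with \<beta>, and \<beta> is subtracted from that one
  alone. The summand differs from \<beta> because its level is \<open>m\<close>, not 0, and the
  level is unchanged by the subtraction.\<close>

lemma level_sums_diff:
  assumes x: "x \<in> level_sums k" and \<beta>: "\<beta> \<in> \<Delta>" "\<beta> \<noteq> \<alpha>" and pos: "x \<bullet> \<beta> > 0"
  shows "x - \<beta> \<in> level_sums k"
proof -
  obtain f where f: "f ` {..<k} \<subseteq> V" "x = (\<Sum>i<k. f i)"
    using x unfolding level_sums_def by auto
  have "(\<Sum>i<k. f i \<bullet> \<beta>) > 0"
    using pos by (simp add: f(2) inner_sum_left)
  then obtain i where i: "i < k" "f i \<bullet> \<beta> > 0"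
    by (metis lessThan_iff not_less sum_nonpos)
  have fi: "f i \<in> \<Phi>" "coef \<alpha> (f i) = m"
    using f(1) i by auto
  have c: "coef \<alpha> \<beta> = 0"
    using coef_simple[OF \<alpha> \<beta>(1)] \<beta>(2) by simp
  then have "f i \<noteq> \<beta>"
    using fi m_ge_1 by auto
  then have "f i - \<beta> \<in> V"
    using diff_root[OF fi(1) simple_root[OF \<beta>(1)] i(2)] fi c by (simp add: inner_diff_right)
  then have "(f(i := f i - \<beta>)) ` {..<k} \<subseteq> V"
    using f(1) by (auto simp: image_subset_iff)
  moreover have "(\<Sum>j<k. (f(i := f i - \<beta>)) j) = (\<Sum>j<k. f j - (if j = i then \<beta> else 0))"
    by (intro sum.cong) auto
  then have "(\<Sum>j<k. (f(i := f i - \<beta>)) j) = x - \<beta>"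
    using i f(2) by (simp add: sum_subtractf)
  ultimately show ?thesis
    unfolding level_sums_def by (intro CollectI exI[of _ "f(i := f i - \<beta>)"] conjI) simp_all
qed

text \<open>As for weights of a saturated set: going down from \<open>y\<close>, the difference \<open>y - x\<close> has a positive
  product with one of its own simple constituents, and dominance of \<open>x\<close> passes this on to \<open>y\<close>.\<close>

lemma dominant_mem_level_sums:
  assumes dom: "\<And>\<beta>. \<beta> \<in> \<Delta> \<Longrightarrow> \<beta> \<noteq> \<alpha> \<Longrightarrow> x \<bullet> \<beta> \<ge> 0" and lev: "coef \<alpha> x = k * m"
    and y: "y \<in> level_sums k" "y - x \<in> Qplus"
  shows "x \<in> level_sums k"
proof -
  obtain n where "ht (y - x) = of_nat n"
    using ht_Nats[OF y(2)] by (auto elim: Nats_cases)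
  then show ?thesis
    using y
  proof (induction n arbitrary: y)
    case 0
    then have "y - x = 0"
      by (intro ht_eq_0) auto
    then show ?case
      using 0 by simp
  next
    case (Suc n)
    let ?z = "y - x"
    have "?z \<noteq> 0"
      using Suc.prems(1) by (auto simp: ht_def)
    then have "?z \<bullet> ?z > 0"
      by simp
    then have "(\<Sum>\<beta>\<in>\<Delta>. coef \<beta> ?z * (?z \<bullet> \<beta>)) > 0"
      using inner_coef_expansion[of ?z ?z] by linarith
    then obtain \<beta> where \<beta>: "\<beta> \<in> \<Delta>" "coef \<beta> ?z * (?z \<bullet> \<beta>) > 0"
      by (meson not_less sum_nonpos)
    have "coef \<beta> ?z \<ge> 0"
      using Suc.prems(3) \<beta>(1) by (rule coef_nonneg)
    then have pos: "coef \<beta> ?z > 0" "?z \<bullet> \<beta> > 0"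
      using \<beta>(2) by (auto simp: zero_less_mult_iff)
    \<comment> \<open>Both \<open>x\<close> and \<open>y\<close> have level \<open>k * m\<close>.
      Hence \<beta> is not \<alpha>, and the dominance hypothesis applies to it.\<close>
    have "coef \<alpha> ?z = 0"
      using coef_level_sums[OF Suc.prems(2)] lev by (simp add: inner_diff_right)
    then have "\<beta> \<noteq> \<alpha>"
      using pos by auto
    then have "y \<bullet> \<beta> > 0"
      using pos(2) dom[OF \<beta>(1)] by (simp add: inner_diff_left)
    then have mem: "y - \<beta> \<in> level_sums k"
      using Suc.prems(2) \<beta>(1) \<open>\<beta> \<noteq> \<alpha>\<close> by (intro level_sums_diff)
    have "coef \<gamma> (y - \<beta> - x) \<in> \<nat>" if \<gamma>: "\<gamma> \<in> \<Delta>" for \<gamma>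
    proof -
      obtain l where l: "coef \<gamma> ?z = of_nat l"
        using Suc.prems(3) \<gamma> by (auto simp: Qplus_iff elim: Nats_cases)
      have "coef \<gamma> (y - \<beta> - x) = of_nat l - (if \<beta> = \<gamma> then 1 else 0)"
        using l coef_simple[OF \<gamma> \<beta>(1)] by (simp add: inner_diff_right)
      \<comment> \<open>The truncated subtraction is harmless: the coefficient at \<beta> is
        positive, so \<open>l\<close> is at least 1 there.\<close>
      also have "\<dots> = of_nat (if \<beta> = \<gamma> then l - 1 else l)"
        using l pos(1) by (auto simp: of_nat_diff)
      finally show ?thesis
        by (simp only: of_nat_in_Nats)
    qed
    then have "y - \<beta> - x \<in> Qplus"
      by (simp add: Qplus_iff)
    moreover have "ht (y - \<beta> - x) = of_nat n"
      using Suc.prems(1) ht_simple[OF \<beta>(1)] by (simp add: ht_diff)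
    ultimately show ?case
      using mem by (intro Suc.IH)
  qed
qed

section \<open>Lattice points of the cone over the facet roots\<close>

lemma cone_refl_root:
  assumes "x \<in> lin_combs {0..} V" "\<beta> \<in> \<Delta>" "\<beta> \<noteq> \<alpha>" shows "refl_root \<beta> x \<in> lin_combs {0..} V"
proof -
  obtain q where q: "q ` V \<subseteq> {0..}" "x = (\<Sum>v\<in>V. q v *\<^sub>R v)"
    using assms(1) lin_combs_finite[OF finite_V, of "{0..}"] by auto
  have "refl_root \<beta> x = (\<Sum>v\<in>V. q v *\<^sub>R refl_root \<beta> v)"
    unfolding q(2) by (simp add: linear_sum[OF linear_refl_root] linear_scale[OF linear_refl_root])
  moreover have "q v *\<^sub>R refl_root \<beta> v \<in> lin_combs {0..} V" if "v \<in> V" for v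
    using q(1) that refl_root_V[OF assms(2,3) that]
    by (intro lin_combs_scale[OF finite_V] lin_combs_base) auto
  ultimately show ?thesis
    using lin_combs_sum[OF finite_V, of "{0..}" V "\<lambda>v. q v *\<^sub>R refl_root \<beta> v"] by simp
qed

text \<open>Comparing levels shows that the cone coefficients sum to \<open>k\<close>. The
  difference is therefore the combination of the vectors \<open>\<theta> - v\<close> with the same
  coefficients, hence nonnegative, and its integrality comes from the lattice.\<close>

lemma cone_below_highest:
  assumes x: "x \<in> lin_combs {0..} V" "x \<in> root_lattice \<Phi>" and lev: "coef \<alpha> x = real k * m"
  shows "real k *\<^sub>R \<theta> - x \<in> Qplus"
proof -
  obtain q where q: "q ` V \<subseteq> {0..}" "x = (\<Sum>v\<in>V. q v *\<^sub>R v)"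
    using x(1) lin_combs_finite[OF finite_V, of "{0..}"] by auto
  have "coef \<alpha> x = (\<Sum>v\<in>V. q v * m)"
    unfolding q(2) inner_sum_right by (intro sum.cong) auto
  then have "(\<Sum>v\<in>V. q v) * m = real k * m"
    using lev by (simp add: sum_distrib_right)
  then have k: "(\<Sum>v\<in>V. q v) = real k"
    using m_ge_1 by simp
  have eq: "real k *\<^sub>R \<theta> - x = (\<Sum>v\<in>V. q v *\<^sub>R (\<theta> - v))"
    unfolding k[symmetric] q(2) by (simp add: scaleR_diff_right sum_subtractf scaleR_sum_left)
  have "coef \<gamma> (real k *\<^sub>R \<theta> - x) \<in> \<nat>" if \<gamma>: "\<gamma> \<in> \<Delta>" for \<gamma>
  proof -
    have "coef \<gamma> (real k *\<^sub>R \<theta> - x) = real k * coef \<gamma> \<theta> - coef \<gamma> x"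
      by (simp add: inner_diff_right)
    then have "coef \<gamma> (real k *\<^sub>R \<theta> - x) \<in> \<int>"
      using x(2) \<gamma> root_coef_Ints[OF highest_root \<gamma>] by (auto simp: root_lattice_iff)
    moreover have "coef \<gamma> (real k *\<^sub>R \<theta> - x) \<ge> 0"
    proof -
      have "(\<Sum>v\<in>V. q v * coef \<gamma> (\<theta> - v)) \<ge> 0"
        using q(1) \<gamma> by (intro sum_nonneg mult_nonneg_nonneg coef_nonneg highest_root_ge) auto
      then show ?thesis
        by (simp add: eq inner_sum_right)
    qed
    ultimately show ?thesis
      by (simp add: Nats_altdef2)
  qed
  then show ?thesis
    by (simp add: Qplus_iff)
qed

text \<open>Induction on the height of \<open>k \<theta> - x\<close>. If \<open>x\<close> is not
  dominant away from \<alpha>, a simple reflection raises its height while preserving cone, lattice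
  and level; a dominant \<open>x\<close> is reached from \<open>k \<theta>\<close>.\<close>

lemma lattice_cone_mem_level_sums:
  assumes "x \<in> lin_combs {0..} V" "x \<in> root_lattice \<Phi>" "coef \<alpha> x = real k * m"
  shows "x \<in> level_sums k"
proof -
  obtain n where "ht (real k *\<^sub>R \<theta> - x) = of_nat n"
    using ht_Nats[OF cone_below_highest[OF assms]] by (auto elim: Nats_cases)
  then show ?thesis
    using assms
  proof (induction n arbitrary: x rule: less_induct)
    case (less n)
    note below = cone_below_highest[OF less.prems(2-4)]
    show ?case
    proof (cases "\<forall>\<beta>\<in>\<Delta>. \<beta> \<noteq> \<alpha> \<longrightarrow> x \<bullet> \<beta> \<ge> 0")
      case True
      have "real k *\<^sub>R \<theta> \<in> level_sums k"
        unfolding level_sums_def using highest_root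
        by (intro CollectI exI[of _ "\<lambda>_. \<theta>"]) (auto simp: sum_constant_scaleR)
      then show ?thesis
        using dominant_mem_level_sums[of x k, OF _ less.prems(4) _ below] True by blast
    next
      case False
      then obtain \<beta> where \<beta>: "\<beta> \<in> \<Delta>" "\<beta> \<noteq> \<alpha>" "x \<bullet> \<beta> < 0"
        by force
      let ?y = "refl_root \<beta> x" and ?a = "2 * (x \<bullet> \<beta>) / (\<beta> \<bullet> \<beta>)"
      have "\<beta> \<noteq> 0"
        using \<beta>(3) by auto
      then have neg: "?a < 0"
        using \<beta>(3) by (simp add: divide_less_0_iff)
      \<comment> \<open>The crystallographic condition concerns pairs of roots, so it is extended to
        the lattice vector \<open>x\<close> by integral expansion.\<close>
      have "2 * (\<beta> \<bullet> x) / (\<beta> \<bullet> \<beta>) = (\<Sum>\<gamma>\<in>\<Delta>. coef \<gamma> x * (2 * (\<gamma> \<bullet> \<beta>) / (\<beta> \<bullet> \<beta>)))"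
        unfolding inner_coef_expansion[of \<beta> x]
        by (simp add: sum_distrib_left sum_divide_distrib mult_ac inner_commute)
      moreover have "\<dots> \<in> \<int>"
        using less.prems(3) crystallographic \<beta>(1) simple_root
        by (intro Ints_sum Ints_mult) (auto simp: root_lattice_iff crystallographic_def)
      ultimately have a: "?a \<in> \<int>"
        by (simp add: inner_commute)
      have y: "?y \<in> lin_combs {0..} V" "coef \<alpha> ?y = real k * m"
        using cone_refl_root[OF less.prems(2) \<beta>(1,2)] coef_refl_root[OF \<beta>(1,2)] less.prems(4) by auto
      have lat: "?y \<in> root_lattice \<Phi>"
        using less.prems(3) a \<beta>(1)
        by (auto simp: root_lattice_iff refl_root_def inner_diff_right coef_simple simp del: times_divide_eq_left)
      obtain n' where n': "ht (real k *\<^sub>R \<theta> - ?y) = of_nat n'"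
        using ht_Nats[OF cone_below_highest[OF y(1) lat y(2)]] by (auto elim: Nats_cases)
      have "ht ?y = ht x - ?a"
        unfolding refl_root_def ht_diff ht_scaleR ht_simple[OF \<beta>(1)] by simp
      then have "real n' < real n"
        using n' less.prems(1) neg by (simp add: ht_diff)
      then have "?y \<in> level_sums k"
        using less.IH[OF _ n' y(1) lat y(2)] by simp
      \<comment> \<open>The reflection is an involution preserving \<open>level_sums k\<close>, so
        membership passes back to \<open>x\<close>.\<close>
      then show ?thesis
        using level_sums_refl_root[OF _ \<beta>(1,2)] refl_root_refl_root by metis
    qed
  qed
qed

section \<open>The two implications of the equivalence\<close>

lemma integrally_closed_if_minuscule:
  assumes "m = 1"
  shows "integrally_closed \<Phi> (root_facet \<Phi> \<Delta> \<alpha>)"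
  unfolding integrally_closed_def face_cone_def face_roots_facet
proof (intro equalityI subsetI IntI)
  fix x assume x: "x \<in> lin_combs {q \<in> \<rat>. 0 \<le> q} V \<inter> root_lattice \<Phi>"
  \<comment> \<open>The level argument works with nonnegative real coefficients, so rationality is
    dropped here.\<close>
  then have cone: "x \<in> lin_combs {0..} V"
    using lin_combs_mono[of "{q \<in> \<rat>. 0 \<le> q}" "{0..}" V V] by auto
  obtain q where q: "q ` V \<subseteq> {0..}" "x = (\<Sum>v\<in>V. q v *\<^sub>R v)"
    using cone lin_combs_finite[OF finite_V, of "{0..}"] by auto
  have "coef \<alpha> x = (\<Sum>v\<in>V. q v * m)"
    unfolding q(2) inner_sum_right by (intro sum.cong) auto
  also have "\<dots> \<ge> 0"
    using q(1) m_ge_1 by (intro sum_nonneg mult_nonneg_nonneg) auto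
  finally have "coef \<alpha> x \<ge> 0" .
  moreover have "coef \<alpha> x \<in> \<int>"
    using x \<alpha> by (auto simp: root_lattice_iff)
  ultimately have "coef \<alpha> x \<in> \<nat>"
    by (simp add: Nats_altdef2)
  \<comment> \<open>Only here does \<open>m = 1\<close> enter: every natural level is then a
    multiple of \<open>m\<close>.\<close>
  then obtain k where "coef \<alpha> x = real k * m"
    using assms by (auto elim: Nats_cases)
  then have "x \<in> level_sums k"
    using lattice_cone_mem_level_sums cone x by blast
  then obtain f where f: "f ` {..<k} \<subseteq> V" "x = (\<Sum>i<k. f i)"
    unfolding level_sums_def by auto
  then show "x \<in> lin_combs \<nat> V"
    unfolding f(2) by (intro lin_combs_sum[OF finite_V] lin_combs_base) auto
next
  fix x assume x: "x \<in> lin_combs \<nat> V"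
  have "\<nat> \<subseteq> {q :: real. q \<in> \<rat> \<and> 0 \<le> q}"
    using Nats_nonneg Nats_subset_Rats by auto
  from lin_combs_mono[OF this subset_refl] show "x \<in> lin_combs {q \<in> \<rat>. 0 \<le> q} V"
    using x by blast
  have "V \<subseteq> \<Phi>"
    by blast
  from lin_combs_mono[OF Nats_subset_Ints this] show "x \<in> root_lattice \<Phi>"
    unfolding root_lattice_def using x by blast
qed

text \<open>Some \<open>v\<close> in \<open>V\<close> is not orthogonal to \<beta>. Both
  \<open>v\<close> and its reflection lie in \<open>V\<close>, and they differ by a nonzero integral
  multiple of \<beta>.\<close>

lemma rational_span_adjacent:
  assumes \<gamma>: "\<gamma> \<in> lin_combs \<rat> V" and \<beta>: "\<beta> \<in> \<Delta>" "\<beta> \<noteq> \<alpha>" and adj: "\<gamma> \<bullet> \<beta> \<noteq> 0"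
  shows "\<beta> \<in> lin_combs \<rat> V"
proof -
  obtain c where c: "\<gamma> = (\<Sum>v\<in>V. c v *\<^sub>R v)"
    using \<gamma> unfolding lin_combs_finite[OF finite_V Rats_0] by auto
  have "\<exists>v\<in>V. v \<bullet> \<beta> \<noteq> 0"
  proof (rule ccontr)
    assume "\<not> ?thesis"
    then have "(\<Sum>v\<in>V. c v * (v \<bullet> \<beta>)) = 0"
      by (intro sum.neutral) auto
    then show False
      using adj by (simp add: c inner_sum_left)
  qed
  then obtain v where v: "v \<in> V" "v \<bullet> \<beta> \<noteq> 0"
    by blast
  define a where "a = 2 * (v \<bullet> \<beta>) / (\<beta> \<bullet> \<beta>)"
  have "a \<in> \<int>"
    using crystallographic v(1) simple_root[OF \<beta>(1)] by (auto simp: a_def crystallographic_def)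
  then have a: "1 / a \<in> \<rat>" "- (1 / a) \<in> \<rat>"
    using Ints_subset_Rats by auto
  have "a \<noteq> 0"
    using v(2) by (auto simp: a_def)
  then have "\<beta> = (1 / a) *\<^sub>R v + (- (1 / a)) *\<^sub>R refl_root \<beta> v"
    by (simp add: refl_root_def a_def[symmetric] scaleR_diff_right)
  also have "\<dots> \<in> lin_combs \<rat> V"
    using a v(1) refl_root_V[OF \<beta> v(1)] finite_V
    by (intro lin_combs_add lin_combs_scale lin_combs_base Rats_add Rats_mult) auto
  finally show ?thesis .
qed

lemma maximal_root_rational_span:
  assumes "maximal_root \<Phi> \<Delta> \<alpha>"
  shows "\<alpha> \<in> lin_combs \<rat> V"
proof -
  let ?U = "lin_combs \<rat> V" and ?G = "affine_dynkin \<Phi> \<Delta> \<restriction> (verts (affine_dynkin \<Phi> \<Delta>) - {\<alpha>})"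
  have \<theta>: "\<theta> \<in> ?U"
    using highest_root by (intro lin_combs_base) auto
  then have neg\<theta>: "- \<theta> \<in> ?U"
    using lin_combs_scale[OF finite_V, of \<rat> "-1" \<theta>] by simp
  \<comment> \<open>This keeps the affine node among the vertices once \<alpha> is deleted.\<close>
  have "coef \<alpha> (- \<theta>) \<noteq> coef \<alpha> \<alpha>"
    using m_ge_1 coef_simple[OF \<alpha> \<alpha>] by simp
  then have ne: "- \<theta> \<noteq> \<alpha>"
    by metis
  have simple: "\<beta> \<in> ?U" if \<beta>: "\<beta> \<in> \<Delta>" "\<beta> \<noteq> \<alpha>" for \<beta>
  proof -
    \<comment> \<open>Connectedness is strong connectedness of the symmetrized graph, which supplies
      a walk from the affine node to \<beta>.\<close>
    have "(- \<theta>) \<rightarrow>\<^sup>*\<^bsub>mk_symmetric ?G\<^esub> \<beta>"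
      using assms ne \<beta>
      by (auto simp: maximal_root_def connected_def strongly_connected_def affine_dynkin_def Let_def)
    then have "(- \<theta>, \<beta>) \<in> rtrancl_on (verts ?G) (parcs (mk_symmetric ?G))"
      by (simp add: reachable_def)
    then show ?thesis
    proof (induction rule: rtrancl_on_induct)
      case base
      show ?case
        by (rule neg\<theta>)
    next
      case (step y z)
      have "y \<bullet> z \<noteq> 0"
        using step.hyps(2)
        by (auto simp: parcs_mk_symmetric affine_dynkin_def Let_def orthogonal_def inner_commute)
      moreover have "z = - \<theta> \<or> z \<in> \<Delta> \<and> z \<noteq> \<alpha>"
        using step.hyps(4) by (auto simp: affine_dynkin_def Let_def)
      ultimately show ?case
        using neg\<theta> rational_span_adjacent[OF step.IH] by blast
    qed
  qed
  \<comment> \<open>With \<theta> and the other simple roots in the rational span, this expansion is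
    solved for \<alpha>, dividing by the nonzero integer \<open>m\<close>.\<close>
  have "\<theta> = m *\<^sub>R \<alpha> + (\<Sum>\<gamma>\<in>\<Delta> - {\<alpha>}. coef \<gamma> \<theta> *\<^sub>R \<gamma>)"
    by (subst coef_expansion[of \<theta>]) (rule sum.remove[OF finite_simple \<alpha>])
  then have "\<theta> + (\<Sum>\<gamma>\<in>\<Delta> - {\<alpha>}. (- coef \<gamma> \<theta>) *\<^sub>R \<gamma>) = m *\<^sub>R \<alpha>"
    unfolding scaleR_minus_left sum_negf by (metis add_diff_cancel_right' diff_conv_add_uminus)
  then have "\<alpha> = (1 / m) *\<^sub>R (\<theta> + (\<Sum>\<gamma>\<in>\<Delta> - {\<alpha>}. (- coef \<gamma> \<theta>) *\<^sub>R \<gamma>))"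
    using m_ge_1 by simp
  also have "\<dots> \<in> ?U"
  proof -
    have "(- coef \<gamma> \<theta>) *\<^sub>R \<gamma> \<in> ?U" if "\<gamma> \<in> \<Delta> - {\<alpha>}" for \<gamma>
      using that simple root_coef_Ints[OF highest_root, of \<gamma>] Ints_subset_Rats
      by (intro lin_combs_scale[OF finite_V] Rats_mult) auto
    then have "\<theta> + (\<Sum>\<gamma>\<in>\<Delta> - {\<alpha>}. (- coef \<gamma> \<theta>) *\<^sub>R \<gamma>) \<in> ?U"
      using \<theta> by (intro lin_combs_add[OF finite_V] lin_combs_sum[OF finite_V]) auto
    moreover have "1 / m \<in> \<rat>"
      using m_Ints Ints_subset_Rats by auto
    ultimately show ?thesis
      by (intro lin_combs_scale[OF finite_V] Rats_mult) simp_all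
  qed
  finally show ?thesis .
qed

text \<open>Levels of natural combinations of \<open>V\<close> are multiples of \<open>m\<close>, so
  a cone lattice point of level 1 modulo \<open>m\<close> forces \<open>m\<close> to divide
  1.\<close>

lemma minuscule_if_integrally_closed:
  assumes max: "maximal_root \<Phi> \<Delta> \<alpha>" and ic: "integrally_closed \<Phi> (root_facet \<Phi> \<Delta> \<alpha>)"
  shows "m = 1"
proof -
  obtain q where q: "q ` V \<subseteq> \<rat>" "\<alpha> = (\<Sum>v\<in>V. q v *\<^sub>R v)"
    using maximal_root_rational_span[OF max] unfolding lin_combs_finite[OF finite_V Rats_0] by auto
  \<comment> \<open>\<open>N\<close> bounds every \<open>\<bar>q v\<bar>\<close>, so raising all
    coefficients by \<open>N\<close> makes them nonnegative.\<close>
  obtain N :: nat where N: "(\<Sum>v\<in>V. \<bar>q v\<bar>) \<le> real N"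
    using real_arch_simple by blast
  have ge: "0 \<le> q v + real N" if "v \<in> V" for v
  proof -
    have "\<bar>q v\<bar> \<le> (\<Sum>v\<in>V. \<bar>q v\<bar>)"
      using that finite_V by (intro member_le_sum) auto
    then show ?thesis
      using N by linarith
  qed
  let ?x = "\<Sum>v\<in>V. (q v + real N) *\<^sub>R v"
  have x: "?x = \<alpha> + (\<Sum>v\<in>V. real N *\<^sub>R v)"
    using q(2) by (simp add: scaleR_add_left sum.distrib)
  have "(\<lambda>v. q v + real N) ` V \<subseteq> {q \<in> \<rat>. 0 \<le> q}"
    using q(1) ge by auto
  then have "?x \<in> lin_combs {q \<in> \<rat>. 0 \<le> q} V"
    by (subst lin_combs_finite[OF finite_V]) auto
  moreover have "?x \<in> root_lattice \<Phi>"
  proof -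
    have "coef \<gamma> \<alpha> + (\<Sum>v\<in>V. real N * coef \<gamma> v) \<in> \<int>" if "\<gamma> \<in> \<Delta>" for \<gamma>
      using that simple_root[OF \<alpha>] by (intro Ints_add Ints_sum Ints_mult root_coef_Ints) auto
    then show ?thesis
      unfolding x by (simp add: root_lattice_iff inner_add_right inner_sum_right)
  qed
  ultimately have "?x \<in> lin_combs \<nat> V"
    using ic unfolding integrally_closed_def face_cone_def face_roots_facet by blast
  then obtain c where c: "c ` V \<subseteq> \<nat>" "?x = (\<Sum>v\<in>V. c v *\<^sub>R v)"
    using lin_combs_finite[OF finite_V, of \<nat>] by auto
  have "coef \<alpha> ?x = (\<Sum>v\<in>V. c v * m)"
    unfolding c(2) inner_sum_right by (intro sum.cong) auto
  moreover have "coef \<alpha> ?x = 1 + (\<Sum>v\<in>V. real N * m)"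
    unfolding x inner_add_right inner_sum_right using coef_simple[OF \<alpha> \<alpha>] by (auto intro!: sum.cong)
  \<comment> \<open>The two computations of the level of \<open>?x\<close> write 1 as
    \<open>m\<close> times an integer.\<close>
  ultimately have eq: "m * ((\<Sum>v\<in>V. c v) - real (card V * N)) = 1"
    by (simp add: sum_distrib_right[symmetric] algebra_simps)
  have "(\<Sum>v\<in>V. c v) - real (card V * N) \<in> \<int>"
    using c(1) Nats_subset_Ints by (intro Ints_diff Ints_sum) auto
  then obtain i where i: "(\<Sum>v\<in>V. c v) - real (card V * N) = real_of_int i"
    by (rule Ints_cases)
  obtain j where j: "m = real_of_int j"
    using m_Ints by (rule Ints_cases)
  have "real_of_int (j * i) = 1"
    using eq i j by (metis of_int_mult)
  then have "j * i = 1"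
    by linarith
  then show ?thesis
    using j m_ge_1 by (auto simp: zmult_eq_1_iff)
qed

end

theorem corollaryD:
  fixes \<Phi> \<Delta> :: "'a::euclidean_space set" and \<alpha> :: 'a
  assumes "root_system \<Phi>" and "crystallographic \<Phi>" and "reduced_roots \<Phi>" and "irreducible_roots \<Phi>"
    and "root_basis \<Phi> \<Delta>"
    and "\<alpha> \<in> \<Delta>" and "maximal_root \<Phi> \<Delta> \<alpha>"
  shows "integrally_closed \<Phi> (root_facet \<Phi> \<Delta> \<alpha>) \<longleftrightarrow>
           coweight \<Delta> \<alpha> \<bullet> highest_root \<Phi> \<Delta> = 1"
proof -
  interpret based_root_system_node \<Phi> \<Delta> \<alpha>
    using assms by unfold_locales
  show ?thesis
    using integrally_closed_if_minuscule minuscule_if_integrally_closed[OF assms(7)] by blast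
qed

end
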